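(* Let $\mathfrak g$ be a Lie algebra over a field $k$ of characteristic other than $2$, let $N=k\oplus\mathfrak g$ with its coalgebra structure and map $q:N\otimes N\to N$ described in the context, and let $\zeta:\mathfrak g\times\mathfrak g\times\mathfrak g\to\mathfrak g$ be a Lie algebra $3$-cocycle with adjoint action. Define the linear map $\hat\zeta:N\otimes N\otimes N\to N$ by $\hat\zeta((a+x)\otimes(b+y)\otimes(c+z))=\zeta(x,y,z)$ for $a,b,c\in k$, $x,y,z\in\mathfrak g$. Then $\hat\zeta$ satisfies $d^{3,1}(\hat\zeta,0,0)=0$.
   Context: A Lie algebra $3$-cocycle with adjoint action is a totally skew-symmetric trilinear map $\zeta:\mathfrak g\times\mathfrak g\times\mathfrak g\to\mathfrak g$ satisfying, for all $x,y,z,w\in\mathfrak g$, $$\begin{aligned}&[\zeta(x,y,z),w]-[\zeta(x,y,w),z]+[\zeta(x,z,w),y]-[\zeta(y,z,w),x]\\&-\zeta([x,y],z,w)+\zeta([x,z],y,w)-\zeta([x,w],y,z)\\&-\zeta([y,z],x,w)+\zeta([y,w],x,z)-\zeta([z,w],x,y)=0.\end{aligned}$$ $N=k\oplus\mathfrak g$ is the cocommutative coalgebra with $\Delta(1)=1\otimes 1$, $\Delta(x)=x\otimes 1+1\otimes x$, $\epsilon(1)=1$, $\epsilon(x)=0$ for $x\in\mathfrak g$, and $q((a+x)\otimes(b+y))=ab+bx+[x,y]$. For linear $\xi:N^{\otimes 3}\to N$, the map $d^{3,1}(\xi,0,0):N^{\otimes 4}\to N$ is given, in Sweedler notation, by $$\begin{aligned}d^{3,1}(\xi,0,0)(a\otimes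 b\otimes c\otimes d)=\;& q\big(\xi(a\otimes b\otimes c)\otimes d\big)+\xi\big(q(a\otimes c_{(1)})\otimes q(b\otimes c_{(2)})\otimes d\big)\\&+q\big(\xi(a\otimes c_{(1)}\otimes d_{(1)})\otimes q(q(b\otimes c_{(2)})\otimes d_{(2)})\big)\\&+q\big(q(q(a\otimes d_{(1)})\otimes q(c_{(1)}\otimes d_{(2)}))\otimes\xi(b\otimes c_{(2)}\otimes d_{(3)})\big)\\&-\xi\big(q(a\otimes b)\otimes c\otimes d\big)-q\big(\xi(a\otimes b\otimes d_{(1)})\otimes q(c\otimes d_{(2)})\big)\\&-\xi\big(q(a\otimes d_{(1)})\otimes q(b\otimes d_{(2)})\otimes q(c\otimes d_{(3)})\big)\end{aligned}$$ for $a,b,c,d\in N$. *)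

theory Defs
  imports "HOL-Analysis.Product_Vector" "HOL-Library.Poly_Mapping"
begin

section \<open>Tensor powers of a vector space\<close>

text \<open>
  The library has no tensor product of vector spaces over an arbitrary field. The \<open>n\<close>-th tensor
  power of \<open>V\<close> is constructed as usual: it is the vector space of formal linear combinations of
  \<open>n\<close>-tuples (lists of length \<open>n\<close>) of vectors, modulo the subspace spanned by the multilinearity
  relations. Elements of the tensor power are the cosets.
\<close>

definition formal_scale :: "'k::field \<Rightarrow> ('a \<Rightarrow>\<^sub>0 'k) \<Rightarrow> ('a \<Rightarrow>\<^sub>0 'k)"
  where "formal_scale c p = Poly_Mapping.map ((*) c) p"

lemma lookup_formal_scale [simp]:
  "Poly_Mapping.lookup (formal_scale c p) x = c * Poly_Mapping.lookup p x"
  unfolding formal_scale_def by transfer (simp add: when_def)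

lemma vector_space_formal_scale: "vector_space formal_scale"
  by unfold_locales (auto intro!: poly_mapping_eqI simp: lookup_add algebra_simps)

locale tensor_algebra = vector_space scale
  for scale :: "'a::field \<Rightarrow> 'b::ab_group_add \<Rightarrow> 'b"
begin

definition multilinear :: "nat \<Rightarrow> ('b list \<Rightarrow> 'b) \<Rightarrow> bool"
  where "multilinear n f \<longleftrightarrow>
    (\<forall>us vs. length us + 1 + length vs = n \<longrightarrow>
      Vector_Spaces.linear scale scale (\<lambda>x. f (us @ x # vs)))"

lemma multilinear_add:
  assumes "multilinear n f" "length us + 1 + length vs = n"
  shows "f (us @ (x + y) # vs) = f (us @ x # vs) + f (us @ y # vs)"
proof -
  interpret Vector_Spaces.linear scale scale "\<lambda>x. f (us @ x # vs)"
    using assms unfolding multilinear_def by blast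
  show ?thesis by (rule add)
qed

lemma multilinear_scale:
  assumes "multilinear n f" "length us + 1 + length vs = n"
  shows "f (us @ scale c x # vs) = scale c (f (us @ x # vs))"
proof -
  interpret Vector_Spaces.linear scale scale "\<lambda>x. f (us @ x # vs)"
    using assms unfolding multilinear_def by blast
  show ?thesis by (rule scale)
qed

definition tensor_relations :: "nat \<Rightarrow> ('b list \<Rightarrow>\<^sub>0 'a) set"
  where "tensor_relations n =
    {Poly_Mapping.single (us @ (x + y) # vs) 1
       - Poly_Mapping.single (us @ x # vs) 1 - Poly_Mapping.single (us @ y # vs) 1
      | us x y vs. length us + 1 + length vs = n} \<union>
    {Poly_Mapping.single (us @ scale c x # vs) 1 - Poly_Mapping.single (us @ x # vs) c
      | us c x vs. length us + 1 + length vs = n}"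

definition tensor_null :: "nat \<Rightarrow> ('b list \<Rightarrow>\<^sub>0 'a) set"
  where "tensor_null n = module.span formal_scale (tensor_relations n)"

definition tensor_coset :: "nat \<Rightarrow> ('b list \<Rightarrow>\<^sub>0 'a) \<Rightarrow> ('b list \<Rightarrow>\<^sub>0 'a) set"
  where "tensor_coset n p = {r. r - p \<in> tensor_null n}"

definition tensor_power :: "nat \<Rightarrow> ('b list \<Rightarrow>\<^sub>0 'a) set set"
  where "tensor_power n = tensor_coset n ` {p. \<forall>us \<in> Poly_Mapping.keys p. length us = n}"

definition pure_tensor :: "'b list \<Rightarrow> ('b list \<Rightarrow>\<^sub>0 'a) set"
  where "pure_tensor us = tensor_coset (length us) (Poly_Mapping.single us 1)"

definition formal_eval :: "('b list \<Rightarrow> 'b) \<Rightarrow> ('b list \<Rightarrow>\<^sub>0 'a) \<Rightarrow> 'b"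
  where "formal_eval f p =
    (\<Sum>us\<in>Poly_Mapping.keys p. scale (Poly_Mapping.lookup p us) (f us))"

text \<open>
  The linear map from the \<open>n\<close>-th tensor power to \<open>V\<close> induced by an \<open>n\<close>-linear map \<open>f\<close>; by
  \<open>tensor_lift_coset\<close> below, the choice of the representative is immaterial.
\<close>

definition tensor_lift :: "('b list \<Rightarrow> 'b) \<Rightarrow> ('b list \<Rightarrow>\<^sub>0 'a) set \<Rightarrow> 'b"
  where "tensor_lift f t = formal_eval f (SOME p. p \<in> t)"

lemma formal_eval_superset:
  assumes "finite A" "Poly_Mapping.keys p \<subseteq> A"
  shows "formal_eval f p = (\<Sum>us\<in>A. scale (Poly_Mapping.lookup p us) (f us))"
  unfolding formal_eval_def using assms
  by (intro sum.mono_neutral_left) (auto simp: in_keys_iff)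

lemma formal_eval_add: "formal_eval f (p + r) = formal_eval f p + formal_eval f r"
proof -
  let ?A = "Poly_Mapping.keys p \<union> Poly_Mapping.keys r"
  have "Poly_Mapping.keys (p + r) \<subseteq> ?A" by (rule Poly_Mapping.keys_add)
  then show ?thesis
    by (simp add: formal_eval_superset[of ?A] lookup_add scale_left_distrib sum.distrib)
qed

lemma formal_eval_scale: "formal_eval f (formal_scale c p) = scale c (formal_eval f p)"
proof -
  have "Poly_Mapping.keys (formal_scale c p) \<subseteq> Poly_Mapping.keys p"
    by (auto simp: in_keys_iff)
  then show ?thesis
    by (simp add: formal_eval_superset[of "Poly_Mapping.keys p"] scale_sum_right)
qed

lemma formal_eval_0 [simp]: "formal_eval f 0 = 0"
  by (simp add: formal_eval_def)

lemma formal_eval_diff: "formal_eval f (p - r) = formal_eval f p - formal_eval f r"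
  using formal_eval_add[of f "p - r" r] by simp

lemma formal_eval_single [simp]: "formal_eval f (Poly_Mapping.single us c) = scale c (f us)"
  by (cases "c = 0") (simp_all add: formal_eval_def)

lemma formal_eval_null:
  assumes f: "multilinear n f" and p: "p \<in> tensor_null n"
  shows "formal_eval f p = 0"
proof -
  interpret formal: vector_space "formal_scale :: 'a \<Rightarrow> ('b list \<Rightarrow>\<^sub>0 'a) \<Rightarrow> _"
    by (rule vector_space_formal_scale)
  show ?thesis
    using p unfolding tensor_null_def
  proof (induction rule: formal.span_induct_alt)
    case base
    show ?case by simp
  next
    case (step c x y)
    have "formal_eval f x = 0"
      using step(1) multilinear_add[OF f] multilinear_scale[OF f] unfolding tensor_relations_def
      by (auto simp: formal_eval_diff)
    then show ?case using step by (simp add: formal_eval_add formal_eval_scale)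
  qed
qed

lemma tensor_coset_self: "p \<in> tensor_coset n p"
proof -
  interpret formal: vector_space "formal_scale :: 'a \<Rightarrow> ('b list \<Rightarrow>\<^sub>0 'a) \<Rightarrow> _"
    by (rule vector_space_formal_scale)
  show ?thesis by (simp add: tensor_coset_def tensor_null_def formal.span_zero)
qed

lemma tensor_lift_coset:
  assumes "multilinear n f"
  shows "tensor_lift f (tensor_coset n p) = formal_eval f p"
proof -
  have "(SOME r. r \<in> tensor_coset n p) \<in> tensor_coset n p"
    using tensor_coset_self by (rule someI)
  then show ?thesis
    using formal_eval_null[OF assms] formal_eval_diff
    by (fastforce simp: tensor_lift_def tensor_coset_def)
qed

lemma tensor_lift_pure:
  assumes "multilinear (length us) f"
  shows "tensor_lift f (pure_tensor us) = f us"
  using tensor_lift_coset[OF assms] by (simp add: pure_tensor_def)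

end


section \<open>Lie algebras and their 3-cocycles with adjoint action\<close>

locale lie_algebra = vector_space scale
  for scale :: "'k::field \<Rightarrow> 'g::ab_group_add \<Rightarrow> 'g" +
  fixes bracket :: "'g \<Rightarrow> 'g \<Rightarrow> 'g"
  assumes linear_bracket_left: "Vector_Spaces.linear scale scale (\<lambda>x. bracket x y)"
    and linear_bracket_right: "Vector_Spaces.linear scale scale (\<lambda>y. bracket x y)"
    and bracket_self: "bracket x x = 0"
    and jacobi: "bracket x (bracket y z) + bracket y (bracket z x) + bracket z (bracket x y) = 0"
begin

definition lie_3_cocycle :: "('g \<Rightarrow> 'g \<Rightarrow> 'g \<Rightarrow> 'g) \<Rightarrow> bool"
  where "lie_3_cocycle \<zeta> \<longleftrightarrow>
    (\<forall>y z. Vector_Spaces.linear scale scale (\<lambda>x. \<zeta> x y z)) \<and>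
    (\<forall>x z. Vector_Spaces.linear scale scale (\<lambda>y. \<zeta> x y z)) \<and>
    (\<forall>x y. Vector_Spaces.linear scale scale (\<lambda>z. \<zeta> x y z)) \<and>
    (\<forall>x y z. \<zeta> y x z = - \<zeta> x y z \<and> \<zeta> x z y = - \<zeta> x y z \<and> \<zeta> z y x = - \<zeta> x y z) \<and>
    (\<forall>x y z w.
      bracket (\<zeta> x y z) w - bracket (\<zeta> x y w) z + bracket (\<zeta> x z w) y - bracket (\<zeta> y z w) x
      - \<zeta> (bracket x y) z w + \<zeta> (bracket x z) y w - \<zeta> (bracket x w) y z
      - \<zeta> (bracket y z) x w + \<zeta> (bracket y w) x z - \<zeta> (bracket z w) x y = 0)"


section \<open>The coalgebra \<open>N = k \<oplus> \<gg>\<close>\<close>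

text \<open>The pair \<open>(a, x)\<close> is the element \<open>a + x\<close> of \<open>N\<close>; the unit of \<open>k\<close> is \<open>(1, 0)\<close>.\<close>

definition N_scale :: "'k \<Rightarrow> 'k \<times> 'g \<Rightarrow> 'k \<times> 'g"
  where "N_scale = module_prod.scale (*) scale"

lemma N_scale_simp: "N_scale c (a, x) = (c * a, scale c x)"
proof -
  interpret k: vector_space "(*) :: 'k \<Rightarrow> 'k \<Rightarrow> 'k" by unfold_locales (auto simp: algebra_simps)
  interpret kg: vector_space_prod "(*) :: 'k \<Rightarrow> 'k \<Rightarrow> 'k" scale ..
  show ?thesis unfolding N_scale_def by (rule kg.scale_prod)
qed

sublocale N: tensor_algebra N_scale
  by unfold_locales (auto simp: N_scale_simp scale_left_distrib scale_right_distrib distrib_left distrib_right)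

text \<open>
  The comultiplication \<open>\<Delta>(a + x) = a (1 \<otimes> 1) + x \<otimes> 1 + 1 \<otimes> x\<close>, an element of \<open>N \<otimes> N\<close>.
\<close>

definition comult :: "'k \<times> 'g \<Rightarrow> (('k \<times> 'g) list \<Rightarrow>\<^sub>0 'k) set"
  where "comult u = N.tensor_coset 2
    (Poly_Mapping.single [(1, 0), (1, 0)] (fst u)
      + Poly_Mapping.single [(0, snd u), (1, 0)] 1 + Poly_Mapping.single [(1, 0), (0, snd u)] 1)"

definition counit :: "'k \<times> 'g \<Rightarrow> 'k"
  where "counit u = fst u"

text \<open>
  The linear extensions of \<open>u \<otimes> v \<mapsto> f u v\<close> and so on (for multilinear \<open>f\<close>).
\<close>

definition lift2 :: "('k \<times> 'g \<Rightarrow> 'k \<times> 'g \<Rightarrow> 'k \<times> 'g) \<Rightarrow> (('k \<times> 'g) list \<Rightarrow>\<^sub>0 'k) set \<Rightarrow> 'k \<times> 'g"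
  where "lift2 f = N.tensor_lift (\<lambda>us. f (us ! 0) (us ! 1))"

definition lift3 :: "('k \<times> 'g \<Rightarrow> 'k \<times> 'g \<Rightarrow> 'k \<times> 'g \<Rightarrow> 'k \<times> 'g)
    \<Rightarrow> (('k \<times> 'g) list \<Rightarrow>\<^sub>0 'k) set \<Rightarrow> 'k \<times> 'g"
  where "lift3 f = N.tensor_lift (\<lambda>us. f (us ! 0) (us ! 1) (us ! 2))"

definition lift4 :: "('k \<times> 'g \<Rightarrow> 'k \<times> 'g \<Rightarrow> 'k \<times> 'g \<Rightarrow> 'k \<times> 'g \<Rightarrow> 'k \<times> 'g)
    \<Rightarrow> (('k \<times> 'g) list \<Rightarrow>\<^sub>0 'k) set \<Rightarrow> 'k \<times> 'g"
  where "lift4 f = N.tensor_lift (\<lambda>us. f (us ! 0) (us ! 1) (us ! 2) (us ! 3))"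

text \<open>
  Sweedler notation: \<open>sweedler2 f c\<close> is \<open>f(c\<^sub>(\<^sub>1\<^sub>), c\<^sub>(\<^sub>2\<^sub>))\<close>, and \<open>sweedler3 f d\<close> is
  \<open>f(d\<^sub>(\<^sub>1\<^sub>), d\<^sub>(\<^sub>2\<^sub>), d\<^sub>(\<^sub>3\<^sub>))\<close>, the value of \<open>f\<close> on \<open>(\<Delta> \<otimes> id) (\<Delta> d)\<close>.
\<close>

definition sweedler2 :: "('k \<times> 'g \<Rightarrow> 'k \<times> 'g \<Rightarrow> 'k \<times> 'g) \<Rightarrow> 'k \<times> 'g \<Rightarrow> 'k \<times> 'g"
  where "sweedler2 f c = lift2 f (comult c)"

definition sweedler3 :: "('k \<times> 'g \<Rightarrow> 'k \<times> 'g \<Rightarrow> 'k \<times> 'g \<Rightarrow> 'k \<times> 'g) \<Rightarrow> 'k \<times> 'g \<Rightarrow> 'k \<times> 'g"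
  where "sweedler3 f d = sweedler2 (\<lambda>d' d3. sweedler2 (\<lambda>d1 d2. f d1 d2 d3) d') d"

definition q :: "(('k \<times> 'g) list \<Rightarrow>\<^sub>0 'k) set \<Rightarrow> 'k \<times> 'g"
  where "q = lift2 (\<lambda>(a, x) (b, y). (a * b, scale b x + bracket x y))"

definition hat :: "('g \<Rightarrow> 'g \<Rightarrow> 'g \<Rightarrow> 'g) \<Rightarrow> (('k \<times> 'g) list \<Rightarrow>\<^sub>0 'k) set \<Rightarrow> 'k \<times> 'g"
  where "hat \<zeta> = lift3 (\<lambda>(a, x) (b, y) (c, z). (0, \<zeta> x y z))"

lemma linear_N_I:
  assumes "\<And>u v. f (u + v) = f u + f v" "\<And>c u. f (N_scale c u) = N_scale c (f u)"
  shows "Vector_Spaces.linear N_scale N_scale f"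
  using assms
  by (intro Vector_Spaces.linear.intro module_hom.intro module_hom_axioms.intro
      N.module_axioms N.vector_space_axioms) auto

lemma multilinear_2I:
  assumes "\<And>v. Vector_Spaces.linear N_scale N_scale (\<lambda>u. f u v)"
    and "\<And>u. Vector_Spaces.linear N_scale N_scale (\<lambda>v. f u v)"
  shows "N.multilinear 2 (\<lambda>us. f (us ! 0) (us ! 1))"
  unfolding N.multilinear_def
proof (intro allI impI)
  fix us vs :: "('k \<times> 'g) list"
  assume "length us + 1 + length vs = 2"
  then consider v where "us = []" "vs = [v]" | u where "us = [u]" "vs = []"
    by (cases us; cases vs) auto
  then show "Vector_Spaces.linear N_scale N_scale (\<lambda>x. f ((us @ x # vs) ! 0) ((us @ x # vs) ! 1))"
    using assms by cases auto
qed

lemma multilinear_3I: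
  assumes "\<And>v w. Vector_Spaces.linear N_scale N_scale (\<lambda>u. f u v w)"
    and "\<And>u w. Vector_Spaces.linear N_scale N_scale (\<lambda>v. f u v w)"
    and "\<And>u v. Vector_Spaces.linear N_scale N_scale (\<lambda>w. f u v w)"
  shows "N.multilinear 3 (\<lambda>us. f (us ! 0) (us ! 1) (us ! 2))"
  unfolding N.multilinear_def
proof (intro allI impI)
  fix us vs :: "('k \<times> 'g) list"
  assume "length us + 1 + length vs = 3"
  then have "length us = 0 \<and> length vs = 2 \<or> length us = 1 \<and> length vs = 1
      \<or> length us = 2 \<and> length vs = 0"
    by linarith
  then consider v w where "us = []" "vs = [v, w]" | u w where "us = [u]" "vs = [w]"
    | u v where "us = [u, v]" "vs = []"
    by (auto simp: length_Suc_conv numeral_2_eq_2)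
  then show "Vector_Spaces.linear N_scale N_scale
      (\<lambda>x. f ((us @ x # vs) ! 0) ((us @ x # vs) ! 1) ((us @ x # vs) ! 2))"
    using assms by cases (auto simp: numeral_eq_Suc)
qed

lemma bracket_simps:
  "bracket (x + y) z = bracket x z + bracket y z" "bracket x (y + z) = bracket x y + bracket x z"
  "bracket (scale c x) z = scale c (bracket x z)" "bracket x (scale c z) = scale c (bracket x z)"
  using linear_bracket_left[of z] linear_bracket_right[of x]
  by (auto simp: Vector_Spaces.linear_def module_hom_def module_hom_axioms_def)

lemma q_pure: "q (N.pure_tensor [(a, x), (b, y)]) = (a * b, scale b x + bracket x y)"
proof -
  have "N.multilinear 2
      (\<lambda>us. (\<lambda>(a, x) (b, y). (a * b, scale b x + bracket x y)) (us ! 0) (us ! 1))"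
    by (intro multilinear_2I linear_N_I)
      (auto simp: N_scale_simp bracket_simps algebra_simps)
  from N.tensor_lift_pure[of "[(a, x), (b, y)]", simplified, OF this[unfolded numeral_2_eq_2]]
  show ?thesis unfolding q_def lift2_def by (simp add: numeral_2_eq_2)
qed

lemma hat_pure:
  assumes "lie_3_cocycle \<zeta>"
  shows "hat \<zeta> (N.pure_tensor [(a, x), (b, y), (c, z)]) = (0, \<zeta> x y z)"
proof -
  have lin: "Vector_Spaces.linear scale scale (\<lambda>x. \<zeta> x y z)"
    "Vector_Spaces.linear scale scale (\<lambda>y. \<zeta> x y z)"
    "Vector_Spaces.linear scale scale (\<lambda>z. \<zeta> x y z)" for x y z
    using assms unfolding lie_3_cocycle_def by blast+
  have simps: "\<zeta> (x + x') y z = \<zeta> x y z + \<zeta> x' y z" "\<zeta> (scale c x) y z = scale c (\<zeta> x y z)"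
    "\<zeta> x (y + y') z = \<zeta> x y z + \<zeta> x y' z" "\<zeta> x (scale c y) z = scale c (\<zeta> x y z)"
    "\<zeta> x y (z + z') = \<zeta> x y z + \<zeta> x y z'" "\<zeta> x y (scale c z) = scale c (\<zeta> x y z)"
    for x x' y y' z z' c
    using lin(1)[of y z] lin(2)[of x z] lin(3)[of x y]
    by (auto simp: Vector_Spaces.linear_def module_hom_def module_hom_axioms_def)
  have "N.multilinear 3
      (\<lambda>us. (\<lambda>(a, x) (b, y) (c, z). (0, \<zeta> x y z)) (us ! 0) (us ! 1) (us ! 2))"
    by (intro multilinear_3I linear_N_I) (auto simp: N_scale_simp simps)
  from N.tensor_lift_pure[of "[(a, x), (b, y), (c, z)]", simplified, OF this[unfolded numeral_3_eq_3]]
  show ?thesis unfolding hat_def lift3_def by (simp add: numeral_3_eq_3)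
qed

lemma sweedler2_eq:
  assumes "\<And>v. Vector_Spaces.linear N_scale N_scale (\<lambda>u. f u v)"
    and "\<And>u. Vector_Spaces.linear N_scale N_scale (\<lambda>v. f u v)"
  shows "sweedler2 f (a, x) = N_scale a (f (1, 0) (1, 0)) + f (0, x) (1, 0) + f (1, 0) (0, x)"
  unfolding sweedler2_def lift2_def comult_def
  using N.tensor_lift_coset[OF multilinear_2I[OF assms]] by (simp add: N.formal_eval_add)

text \<open>
  The map \<open>d\<^sup>3\<^sup>,\<^sup>1(\<xi>, 0, 0)\<close> from the fourth tensor power of \<open>N\<close> to \<open>N\<close>, for a linear map \<open>\<xi>\<close> from
  the third tensor power of \<open>N\<close> to \<open>N\<close>.
\<close>

definition d31 :: "((('k \<times> 'g) list \<Rightarrow>\<^sub>0 'k) set \<Rightarrow> 'k \<times> 'g)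
    \<Rightarrow> (('k \<times> 'g) list \<Rightarrow>\<^sub>0 'k) set \<Rightarrow> 'k \<times> 'g"
  where "d31 \<xi> =
    (let Q = (\<lambda>u v. q (N.pure_tensor [u, v]));
         X = (\<lambda>u v w. \<xi> (N.pure_tensor [u, v, w]))
     in lift4 (\<lambda>a b c d.
         Q (X a b c) d
       + sweedler2 (\<lambda>c1 c2. X (Q a c1) (Q b c2) d) c
       + sweedler2 (\<lambda>c1 c2. sweedler2 (\<lambda>d1 d2. Q (X a c1 d1) (Q (Q b c2) d2)) d) c
       + sweedler2 (\<lambda>c1 c2. sweedler3 (\<lambda>d1 d2 d3. Q (Q (Q a d1) (Q c1 d2)) (X b c2 d3)) d) c
       - X (Q a b) c d
       - sweedler2 (\<lambda>d1 d2. Q (X a b d1) (Q c d2)) d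
       - sweedler3 (\<lambda>d1 d2 d3. X (Q a d1) (Q b d2) (Q c d3)) d))"

end

end

theory Submission
  imports Defs
begin

text \<open>
  The tensors \<open>u\<^sub>1 \<otimes> u\<^sub>2 \<otimes> u\<^sub>3 \<otimes> u\<^sub>4\<close> span the fourth tensor power of \<open>N\<close>, so it suffices to evaluate
  \<open>d\<^sup>3\<^sup>,\<^sup>1(\<zeta>\<^sup>^, 0, 0)\<close> on \<open>(a + x) \<otimes> (b + y) \<otimes> (c + z) \<otimes> (d + w)\<close>. Three facts make this short: \<open>1\<close> is a right
  unit for \<open>q\<close>; \<open>q(1 \<otimes> u) = \<epsilon>(u)\<close>, which has no component in \<open>\<gg>\<close>; and \<open>\<zeta>\<^sup>^\<close> vanishes as soon as
  one argument is a scalar. In a Sweedler sum, the expanded argument contributes its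
  scalar part times the value at \<open>1, 1\<close> (or \<open>1, 1, 1\<close>), and its part in \<open>\<gg>\<close> placed in one factor
  with \<open>1\<close> in the others; most of these terms vanish by the three facts. The seven summands of \<open>d\<^sup>3\<^sup>,\<^sup>1\<close> become, in order of appearance,
  \<^item> \<open>d \<zeta>(x,y,z) + [\<zeta>(x,y,z),w]\<close>
  \<^item> \<open>c \<zeta>(x,y,w) + \<zeta>([x,z],y,w) + \<zeta>(x,[y,z],w)\<close>
  \<^item> \<open>b \<zeta>(x,z,w) + [\<zeta>(x,z,w),y]\<close>
  \<^item> \<open>[x,\<zeta>(y,z,w)]\<close>
  \<^item> \<open>- b \<zeta>(x,z,w) - \<zeta>([x,y],z,w)\<close>
  \<^item> \<open>- c \<zeta>(x,y,w) - [\<zeta>(x,y,w),z]\<close>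
  \<^item> \<open>- d \<zeta>(x,y,z) - \<zeta>([x,w],y,z) - \<zeta>(x,[y,w],z) - \<zeta>(x,y,[z,w])\<close>

  The terms with a scalar coefficient cancel in pairs. Moving each bracket to the first slot of
  \<open>\<zeta>\<close> and \<open>x\<close> to the second slot of the bracket, by skew-symmetry, turns the ten remaining terms
  into the left-hand side of the cocycle identity.
\<close>

lemma (in lie_algebra) bracket_zero [simp]: "bracket 0 x = 0" "bracket x 0 = 0"
  using bracket_simps(1)[of 0 0 x] bracket_simps(2)[of x 0 0] by simp_all

lemma (in lie_algebra) bracket_skew: "bracket y x = - bracket x y"
proof -
  have "bracket y x + bracket x y = 0"
    using bracket_self[of "x + y", unfolded bracket_simps] by (simp add: bracket_self)
  then show ?thesis by (rule eq_neg_iff_add_eq_0[THEN iffD2])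
qed

lemma (in lie_algebra) q_pure_components:
  "q (N.pure_tensor [u, v]) = (fst u * fst v, scale (fst v) (snd u) + bracket (snd u) (snd v))"
  using q_pure[of "fst u" "snd u" "fst v" "snd v"] by simp

lemma (in lie_algebra) N_scale_components: "N_scale c u = (c * fst u, scale c (snd u))"
  using N_scale_simp[of c "fst u" "snd u"] by simp

text \<open>
  The threefold Sweedler sum is a twofold one whose summand is itself a twofold sum. The next two
  lemmas say that this summand is linear in the factor being split again and in the other one, which
  is what the expansion of the outer sum requires.
\<close>

lemma (in lie_algebra) sweedler2_arg_linear:
  assumes "\<And>v. Vector_Spaces.linear N_scale N_scale (\<lambda>u. f u v)"
    and "\<And>u. Vector_Spaces.linear N_scale N_scale (\<lambda>v. f u v)"
  shows "Vector_Spaces.linear N_scale N_scale (sweedler2 f)"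
proof -
  interpret left: Vector_Spaces.linear N_scale N_scale "\<lambda>u. f u (1, 0)" by (rule assms(1))
  interpret right: Vector_Spaces.linear N_scale N_scale "\<lambda>v. f (1, 0) v" by (rule assms(2))
  have parts:
    "f (0, x + y) (1, 0) = f (0, x) (1, 0) + f (0, y) (1, 0)"
    "f (1, 0) (0, x + y) = f (1, 0) (0, x) + f (1, 0) (0, y)"
    "f (0, scale c x) (1, 0) = N_scale c (f (0, x) (1, 0))"
    "f (1, 0) (0, scale c x) = N_scale c (f (1, 0) (0, x))" for c x y
    using left.add[of "(0, x)" "(0, y)"] right.add[of "(0, x)" "(0, y)"]
      left.scale[of c "(0, x)"] right.scale[of c "(0, x)"]
    by (simp_all add: N_scale_simp)
  have eq: "sweedler2 f u = N_scale (fst u) (f (1, 0) (1, 0)) + f (0, snd u) (1, 0) + f (1, 0) (0, snd u)" for u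
    using sweedler2_eq[OF assms, of "fst u" "snd u"] by simp
  show ?thesis
    by (rule linear_N_I)
      (simp_all add: eq N_scale_components parts algebra_simps prod_eq_iff)
qed

lemma (in lie_algebra) sweedler2_linear:
  assumes "\<And>v w. Vector_Spaces.linear N_scale N_scale (\<lambda>u. f u v w)"
    and "\<And>u w. Vector_Spaces.linear N_scale N_scale (\<lambda>v. f u v w)"
    and "\<And>u v. Vector_Spaces.linear N_scale N_scale (\<lambda>w. f u v w)"
  shows "Vector_Spaces.linear N_scale N_scale (\<lambda>w. sweedler2 (\<lambda>u v. f u v w) c)"
proof -
  obtain a x where c: "c = (a, x)" by (cases c)
  have "f u v (w + w') = f u v w + f u v w'" "f u v (N_scale r w) = N_scale r (f u v w)" for u v w w' r
    using assms(3)[of u v]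
    unfolding Vector_Spaces.linear_def module_hom_def module_hom_axioms_def by blast+
  then show ?thesis
    unfolding c by (auto intro!: linear_N_I simp: sweedler2_eq[OF assms(1,2)]
        N_scale_components algebra_simps prod_eq_iff)
qed

text \<open>
  The four terms come from \<open>(\<Delta> \<otimes> id)(\<Delta>(a + x)) =
  a (1 \<otimes> 1 \<otimes> 1) + x \<otimes> 1 \<otimes> 1 + 1 \<otimes> x \<otimes> 1 + 1 \<otimes> 1 \<otimes> x\<close>. Splitting the first factor of
  \<open>x \<otimes> 1\<close> gives the second and third terms, splitting that of \<open>1 \<otimes> x\<close> the last one; the other terms
  of the two expansions have a zero coefficient or a zero factor.
\<close>

lemma (in lie_algebra) sweedler3_eq:
  assumes "\<And>v w. Vector_Spaces.linear N_scale N_scale (\<lambda>u. f u v w)"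
    and "\<And>u w. Vector_Spaces.linear N_scale N_scale (\<lambda>v. f u v w)"
    and "\<And>u v. Vector_Spaces.linear N_scale N_scale (\<lambda>w. f u v w)"
  shows "sweedler3 f (a, x) = N_scale a (f (1, 0) (1, 0) (1, 0))
    + f (0, x) (1, 0) (1, 0) + f (1, 0) (0, x) (1, 0) + f (1, 0) (1, 0) (0, x)"
proof -
  have inner: "sweedler2 (\<lambda>d1 d2. f d1 d2 v) (r, y)
      = N_scale r (f (1, 0) (1, 0) v) + f (0, y) (1, 0) v + f (1, 0) (0, y) v" for v r y
    by (rule sweedler2_eq[OF assms(1,2)])
  have zero: "f 0 v w = 0" "f u 0 w = 0" for u v w
    using module_hom.zero[OF Vector_Spaces.linear.axioms(3)[OF assms(1)]]
      module_hom.zero[OF Vector_Spaces.linear.axioms(3)[OF assms(2)]] by blast+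
  have "Vector_Spaces.linear N_scale N_scale (\<lambda>d'. sweedler2 (\<lambda>d1 d2. f d1 d2 v) d')" for v
    by (rule sweedler2_arg_linear[OF assms(1,2)])
  then show ?thesis
    unfolding sweedler3_def
    by (subst sweedler2_eq)
      (auto simp: inner zero zero[unfolded zero_prod_def] N_scale_components prod_eq_iff
        intro: sweedler2_linear[OF assms])
qed

text \<open>
  Whatever representative is chosen for \<open>t\<close>, the extension evaluates to a linear combination of values
  of \<open>f\<close>. This reduces the theorem to pure tensors.
\<close>

lemma (in lie_algebra) lift4_eq_0:
  assumes "\<And>u v w s. f u v w s = 0"
  shows "lift4 f t = 0"
  by (simp add: lift4_def N.tensor_lift_def N.formal_eval_def assms)

text \<open>
  The formulas \<open>term2\<close> to \<open>term7\<close> are the summands of \<open>d\<^sup>3\<^sup>,\<^sup>1(\<zeta>\<^sup>^, 0, 0)\<close> that contain a Sweedler sum.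
  Where the sums over \<open>c\<close> and \<open>d\<close> are nested, the one over \<open>d\<close> is evaluated for arbitrary
  \<open>c1\<close> and \<open>c2\<close>, since the expansion of the one over \<open>c\<close> needs linearity in both.
\<close>

lemma (in lie_algebra) d31_hat_eq_0:
  assumes "lie_3_cocycle \<zeta>"
  shows "d31 (hat \<zeta>) t = 0"
proof -
  have lin: "Vector_Spaces.linear scale scale (\<lambda>x. \<zeta> x y z)"
    "Vector_Spaces.linear scale scale (\<lambda>y. \<zeta> x y z)"
    "Vector_Spaces.linear scale scale (\<lambda>z. \<zeta> x y z)" for x y z
    using assms unfolding lie_3_cocycle_def by blast+
  have add_scale: "\<zeta> (x + x') y z = \<zeta> x y z + \<zeta> x' y z" "\<zeta> (scale c x) y z = scale c (\<zeta> x y z)"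
    "\<zeta> x (y + y') z = \<zeta> x y z + \<zeta> x y' z" "\<zeta> x (scale c y) z = scale c (\<zeta> x y z)"
    "\<zeta> x y (z + z') = \<zeta> x y z + \<zeta> x y z'" "\<zeta> x y (scale c z) = scale c (\<zeta> x y z)"
    for x x' y y' z z' c
    using lin(1)[of y z] lin(2)[of x z] lin(3)[of x y]
    by (auto simp: Vector_Spaces.linear_def module_hom_def module_hom_axioms_def)
  have zero: "\<zeta> 0 y z = 0" "\<zeta> x 0 z = 0" "\<zeta> x y 0 = 0" for x y z
    using add_scale(1)[of 0 0] add_scale(3)[of _ 0 0] add_scale(5)[of _ _ 0 0] by simp_all
  have hat: "hat \<zeta> (N.pure_tensor [u, v, w]) = (0, \<zeta> (snd u) (snd v) (snd w))" for u v w
    using hat_pure[OF assms, of "fst u" "snd u" "fst v" "snd v" "fst w" "snd w"] by simp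
  note comps = N_scale_components q_pure_components hat
  note ring = bracket_simps add_scale zero algebra_simps prod_eq_iff
  have skew: "\<zeta> x y z = - \<zeta> y x z" "\<zeta> x y z = \<zeta> z x y" for x y z
  proof -
    have "\<forall>x y z. \<zeta> y x z = - \<zeta> x y z \<and> \<zeta> x z y = - \<zeta> x y z"
      using assms unfolding lie_3_cocycle_def by blast
    then show "\<zeta> x y z = - \<zeta> y x z" "\<zeta> x y z = \<zeta> z x y"
      by (metis, metis minus_minus)
  qed
  have cocycle: "bracket (\<zeta> x y z) w - bracket (\<zeta> x y w) z + bracket (\<zeta> x z w) y - bracket (\<zeta> y z w) x
      - \<zeta> (bracket x y) z w + \<zeta> (bracket x z) y w - \<zeta> (bracket x w) y z
      - \<zeta> (bracket y z) x w + \<zeta> (bracket y w) x z - \<zeta> (bracket z w) x y = 0" for x y z w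
    using assms unfolding lie_3_cocycle_def by blast
  let ?Q = "\<lambda>u v. q (N.pure_tensor [u, v])"
  let ?X = "\<lambda>u v w. hat \<zeta> (N.pure_tensor [u, v, w])"
  have term2: "sweedler2 (\<lambda>c1 c2. ?X (?Q u c1) (?Q v c2) s) (c, z)
      = (0, scale c (\<zeta> (snd u) (snd v) (snd s)) + \<zeta> (bracket (snd u) z) (snd v) (snd s)
          + \<zeta> (snd u) (bracket (snd v) z) (snd s))" for u v s c z
    by (subst sweedler2_eq) (auto intro!: linear_N_I simp: comps ring)
  have inner3: "sweedler2 (\<lambda>d1 d2. ?Q (?X u c1 d1) (?Q (?Q v c2) d2)) (d, w)
      = (0, scale (fst v * fst c2) (\<zeta> (snd u) (snd c1) w)
          + bracket (\<zeta> (snd u) (snd c1) w) (snd (?Q v c2)))" for u v c1 c2 d w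
    by (subst sweedler2_eq) (auto intro!: linear_N_I simp: comps ring)
  have term3: "sweedler2 (\<lambda>c1 c2. sweedler2 (\<lambda>d1 d2. ?Q (?X u c1 d1) (?Q (?Q v c2) d2)) s) (c, z)
      = (0, scale (fst v) (\<zeta> (snd u) z (snd s)) + bracket (\<zeta> (snd u) z (snd s)) (snd v))"
    for u v s c z
    by (cases s, simp only: inner3, subst sweedler2_eq)
      (auto intro!: linear_N_I simp: comps ring)
  have inner4: "sweedler3 (\<lambda>d1 d2 d3. ?Q (?Q (?Q u d1) (?Q c1 d2)) (?X v c2 d3)) (d, w)
      = (0, bracket (snd (?Q u c1)) (\<zeta> (snd v) (snd c2) w))" for u v c1 c2 d w
    by (subst sweedler3_eq) (auto intro!: linear_N_I simp: comps ring)
  have term4: "sweedler2 (\<lambda>c1 c2. sweedler3 (\<lambda>d1 d2 d3. ?Q (?Q (?Q u d1) (?Q c1 d2)) (?X v c2 d3)) s) (c, z)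
      = (0, bracket (snd u) (\<zeta> (snd v) z (snd s)))" for u v s c z
    by (cases s, simp only: inner4, subst sweedler2_eq)
      (auto intro!: linear_N_I simp: comps ring)
  have term6: "sweedler2 (\<lambda>d1 d2. ?Q (?X u v d1) (?Q r d2)) (d, w)
      = (0, scale (fst r) (\<zeta> (snd u) (snd v) w) + bracket (\<zeta> (snd u) (snd v) w) (snd r))"
    for u v r d w
    by (subst sweedler2_eq) (auto intro!: linear_N_I simp: comps ring)
  have term7: "sweedler3 (\<lambda>d1 d2 d3. ?X (?Q u d1) (?Q v d2) (?Q r d3)) (d, w)
      = (0, scale d (\<zeta> (snd u) (snd v) (snd r)) + \<zeta> (bracket (snd u) w) (snd v) (snd r)
          + \<zeta> (snd u) (bracket (snd v) w) (snd r) + \<zeta> (snd u) (snd v) (bracket (snd r) w))"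
    for u v r d w
    by (subst sweedler3_eq) (auto intro!: linear_N_I simp: comps ring)
  show ?thesis
    unfolding d31_def Let_def
  proof (rule lift4_eq_0)
    fix u v r s :: "'k \<times> 'g"
    obtain a x b y c z d w where eqs: "u = (a, x)" "v = (b, y)" "r = (c, z)" "s = (d, w)"
      by (metis surj_pair)
    \<comment> \<open>The cocycle identity has every inner bracket in the first slot of \<open>\<zeta>\<close>, and \<open>\<zeta>\<close> in the
      first slot of every outer bracket.\<close>
    have moved: "\<zeta> x (bracket y z) w = - \<zeta> (bracket y z) x w"
      "\<zeta> x (bracket y w) z = - \<zeta> (bracket y w) x z"
      "\<zeta> x y (bracket z w) = \<zeta> (bracket z w) x y"
      "bracket x (\<zeta> y z w) = - bracket (\<zeta> y z w) x"
      using skew bracket_skew by blast+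
    show "?Q (?X u v r) s
       + sweedler2 (\<lambda>c1 c2. ?X (?Q u c1) (?Q v c2) s) r
       + sweedler2 (\<lambda>c1 c2. sweedler2 (\<lambda>d1 d2. ?Q (?X u c1 d1) (?Q (?Q v c2) d2)) s) r
       + sweedler2 (\<lambda>c1 c2. sweedler3 (\<lambda>d1 d2 d3. ?Q (?Q (?Q u d1) (?Q c1 d2)) (?X v c2 d3)) s) r
       - ?X (?Q u v) r s
       - sweedler2 (\<lambda>d1 d2. ?Q (?X u v d1) (?Q r d2)) s
       - sweedler3 (\<lambda>d1 d2 d3. ?X (?Q u d1) (?Q v d2) (?Q r d3)) s = 0"
      \<comment> \<open>The nested sums are replaced as wholes before the formula for the simple sum over \<open>s\<close> can
        match inside one of them.\<close>
      unfolding eqs term3 term4 unfolding term2 term6 term7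
      using cocycle[of x y z w]
      by (simp add: comps moved add_scale prod_eq_iff algebra_simps)
  qed
qed

theorem theorem7p8:
  fixes scale :: "'k::field \<Rightarrow> 'g::ab_group_add \<Rightarrow> 'g"
    and bracket :: "'g \<Rightarrow> 'g \<Rightarrow> 'g"
    and \<zeta> :: "'g \<Rightarrow> 'g \<Rightarrow> 'g \<Rightarrow> 'g"
  assumes "lie_algebra scale bracket"
    and "CHAR('k) \<noteq> 2"
    and "lie_algebra.lie_3_cocycle scale bracket \<zeta>"
  shows "\<forall>t \<in> tensor_algebra.tensor_power (lie_algebra.N_scale scale) 4.
    lie_algebra.d31 scale bracket (lie_algebra.hat scale \<zeta>) t = 0"
  using lie_algebra.d31_hat_eq_0[OF assms(1,3)] by blast

end
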